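(* Let $L=\sum_{i=0}^N a_i(x)\partial_x^i$ be a Bochner differential operator of order $N\ge 1$ with $a_0\equiv 0$, having a sequence of monic eigenpolynomials $\{P_n\}_{n\ge 0}$, $\deg P_n=n$, with corresponding eigenvalues $\{\lambda_n\}_{n\ge 0}\subset\mathbb{C}$, i.e. $LP_n=\lambda_nP_n$ for all $n\ge 0$, where $\lambda_0=0$, $\lambda_n\neq 0$ for $n\ge 1$, and the $\lambda_n$ are pairwise distinct. Let $\{\delta_n^{(k)}\}$ be the sequence associated with $L$, and write $P_n(x)=\sum_{j=0}^n b_{n,j}x^j$ with $b_{n,n}=1$. Let $n$ and $i$ be integers with $1\le i\le n$ and $n-i\ge N$. Then $$b_{n,n-i}=\frac{n(n-1)\cdots(n-i+1)}{\displaystyle\prod_{\ell=1}^{i}\left(\sum_{m=1}^N(-1)^{N-m}\binom{N}{m}\left(\prod_{\substack{j=0\\ j\neq m}}^{N}(n-j)-\prod_{\substack{j=0\\ j\neq m}}^{N}(n-\ell-j)\right)\lambda_m\right)}\det(M),$$ where $M$ is the upper Hessenberg $i\times i$ matrix that has (a) $\displaystyle\frac{1}{n-\ell}\sum_{r=1}^N(-1)^{N-r}\binom{N}{r}\left(\prod_{\substack{j=0\\ j\neq r}}^{N}(n-\ell-j)-\prod_{\substack{j=0\\ j\neq r}}^{N}(n-j)\right)\lambda_r$ as the $\ell$-th entry of the subdiagonal; (b) $\displaystyle\sum_{r=1}^N(-1)^{N-r}\binom{N}{r}\prod_{\substack{j=1\\ j\neq r}}^{N}(n-\ell+1-j)\,\delta_r^{(1)}$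 as the $\ell$-th entry of the main diagonal; (c) $\displaystyle\sum_{r=k}^N(-1)^{N-r}\binom{N}{r}\prod_{\substack{j=1\\ j\neq r}}^{N}(n-\ell+1-j)\,\delta_r^{(k)}$ as the $\ell$-th entry of the $(k-1)$-superdiagonal, for $k=2,\ldots,N-1$; (d) $\displaystyle\prod_{j=1}^{N-1}(n-\ell+1-j)\,\delta_N^{(N)}$ as the $\ell$-th entry of the $(N-1)$-superdiagonal; (e) zeros on the $m$-superdiagonal for every $m\ge N$.
   Context: A Bochner differential operator of order $N$ is an operator $L=\sum_{i=0}^N a_i(x)\partial_x^i$, where each $a_i(x)$ is a polynomial with complex coefficients, $\deg a_i\le i$, and $\partial_x^i$ is the $i$-th derivative with respect to $x$. Set $a_n(x)=0$ for $n>N$ and write $a_n(x)=\sum_{i=0}^n a_{n,i}x^i$ with $a_{n,i}\in\mathbb{C}$. The sequence $\{\delta_n^{(k)}\}$ associated with $L$ is $$\delta_n^{(k)}=\sum_{i=k}^{n}\binom{n}{i}\,i!\,a_{i,i-k},\quad n=0,1,2,\dots,\ k=0,1,\dots,n,$$ and $\delta_n^{(k)}=0$ for $k>n$. For a square matrix $M=(M_{r,c})$, the $\ell$-th entry of the subdiagonal is $M_{\ell+1,\ell}$, the $\ell$-th entry of the main diagonal is $M_{\ell,\ell}$, and the $\ell$-th entry of the $m$-superdiagonal is $M_{\ell,\ell+m}$ (for those $\ell$ for which the position exists). Upper Hessenberg means that all entries below the subdiagonal are zero. Superdiagonals that do not exist in an $i\times i$ matrix are disregarded. *)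

theory Defs
  imports Complex_Main "HOL-Computational_Algebra.Polynomial" "Jordan_Normal_Form.Determinant"
begin

text \<open>
  An operator is given by its order bound \<open>N\<close> and its coefficient sequence \<open>a\<close>, extended by
  \<open>a i = 0\<close> for \<open>i > N\<close>.  The leading coefficient \<open>a N\<close> is not required to be nonzero.
\<close>

definition bochner_operator :: "nat \<Rightarrow> (nat \<Rightarrow> complex poly) \<Rightarrow> bool" where
  "bochner_operator N a \<longleftrightarrow> (\<forall>i\<le>N. degree (a i) \<le> i) \<and> (\<forall>i>N. a i = 0)"

definition apply_operator :: "nat \<Rightarrow> (nat \<Rightarrow> complex poly) \<Rightarrow> complex poly \<Rightarrow> complex poly" where
  "apply_operator N a p = (\<Sum>i=0..N. a i * (pderiv ^^ i) p)"

definition assoc_seq :: "(nat \<Rightarrow> complex poly) \<Rightarrow> nat \<Rightarrow> nat \<Rightarrow> complex" where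
  "assoc_seq a k n =
     (if k \<le> n then \<Sum>i=k..n. of_nat (n choose i) * fact i * coeff (a i) (i - k) else 0)"

definition sub_entry :: "nat \<Rightarrow> (nat \<Rightarrow> complex) \<Rightarrow> nat \<Rightarrow> nat \<Rightarrow> complex" where
  "sub_entry N lam n l =
     1 / (of_nat n - of_nat l) *
     (\<Sum>r=1..N. (-1) ^ (N - r) * of_nat (N choose r) *
        ((\<Prod>j\<in>{0..N} - {r}. of_nat n - of_nat l - of_nat j) -
         (\<Prod>j\<in>{0..N} - {r}. of_nat n - of_nat j)) * lam r)"

definition super_entry ::
  "nat \<Rightarrow> (nat \<Rightarrow> complex poly) \<Rightarrow> nat \<Rightarrow> nat \<Rightarrow> nat \<Rightarrow> complex" where
  "super_entry N a n k l =
     (\<Sum>r=k..N. (-1) ^ (N - r) * of_nat (N choose r) *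
        (\<Prod>j\<in>{1..N} - {r}. of_nat n - of_nat l + 1 - of_nat j) * assoc_seq a k r)"

definition last_super_entry ::
  "nat \<Rightarrow> (nat \<Rightarrow> complex poly) \<Rightarrow> nat \<Rightarrow> nat \<Rightarrow> complex" where
  "last_super_entry N a n l =
     (\<Prod>j=1..N - 1. of_nat n - of_nat l + 1 - of_nat j) * assoc_seq a N N"

text \<open>
  Rows \<open>r\<close> and columns \<open>c\<close> of \<open>hessenberg_entry\<close> are counted from 1.  For \<open>r \<le> c\<close> the position
  lies on the \<open>(k - 1)\<close>-superdiagonal with \<open>k = c - r + 1\<close>; \<open>k = 1\<close> is the main diagonal.
  For \<open>N = 1\<close> the main diagonal is also the \<open>(N - 1)\<close>-superdiagonal; both
  prescriptions agree there, see \<open>super_entry_eq_last_super_entry\<close>.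
\<close>

definition hessenberg_entry ::
  "nat \<Rightarrow> (nat \<Rightarrow> complex poly) \<Rightarrow> (nat \<Rightarrow> complex) \<Rightarrow> nat \<Rightarrow> nat \<Rightarrow> nat \<Rightarrow> complex" where
  "hessenberg_entry N a lam n r c =
     (if r = c + 1 then sub_entry N lam n c
      else if r = c then super_entry N a n 1 r
      else if r < c then
        (let k = c - r + 1 in
         if k \<le> N - 1 then super_entry N a n k r
         else if k = N then last_super_entry N a n r
         else 0)
      else 0)"

definition hessenberg_mat ::
  "nat \<Rightarrow> (nat \<Rightarrow> complex poly) \<Rightarrow> (nat \<Rightarrow> complex) \<Rightarrow> nat \<Rightarrow> nat \<Rightarrow> complex mat" where
  "hessenberg_mat N a lam n i = mat i i (\<lambda>(r, c). hessenberg_entry N a lam n (r + 1) (c + 1))"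

lemma super_entry_eq_last_super_entry:
  assumes "N \<ge> 1"
  shows "super_entry N a n N l = last_super_entry N a n l"
proof -
  have "{1..N} - {N} = {1..N - 1}" using assms by auto
  then show ?thesis by (simp add: super_entry_def last_super_entry_def)
qed

end

theory Submission imports Defs begin

text \<open>
  Write \<open>\<delta>\<^sub>m\<^sup>k\<close> for \<open>assoc_seq a k m\<close>.  The action on monomials is
  \<open>L x^m = (\<Sum>k. \<delta>\<^sub>m\<^sup>k x^(m - k))\<close>, so \<open>\<lambda>\<^sub>m = \<delta>\<^sub>m\<^sup>0\<close>, and comparing coefficients at \<open>x^s\<close> in
  \<open>L P\<^sub>n = \<lambda>\<^sub>n P\<^sub>n\<close> gives a triangular recurrence for the coefficients \<open>b\<close> of \<open>P\<^sub>n\<close>: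
  \<open>(\<lambda>\<^sub>n - \<lambda>\<^sub>s) b\<^sub>s = (\<Sum>k=1..N. \<delta>\<^bsub>s+k\<^esub>\<^sup>k b\<^bsub>s+k\<^esub>)\<close>  (\<open>eigenpolynomial_recurrence\<close>).

  For fixed \<open>k\<close> the number \<open>\<delta>\<^sub>m\<^sup>k\<close> is a polynomial in \<open>m\<close> of degree at most \<open>N\<close>, hence it is
  determined by its values at \<open>0, \<dots>, N\<close>.  The alternating sums in the denominator and in the
  matrix entries are exactly Lagrange's formula at these nodes, up to the factor \<open>N!\<close> which clears
  denominators (\<open>lagrange_interpolation_initial_nodes\<close>).  With \<open>D\<^sub>l = N! (\<lambda>\<^sub>n - \<lambda>\<^bsub>n-l\<^esub>)\<close> the
  \<open>l\<close>-th factor of the denominator is \<open>D\<^sub>l\<close>, the \<open>l\<close>-th subdiagonal entry is \<open>- D\<^sub>l / (n - l)\<close>, and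
  the entry in row \<open>r\<close> on the \<open>(k - 1)\<close>-superdiagonal is
  \<open>N! \<delta>\<^bsub>n-r+1\<^esub>\<^sup>k / (n - r + 1)\<close>.

  Let \<open>u\<^sub>r = (n - r + 1) b\<^bsub>n-r+1\<^esub>\<close>.  The recurrence then says that the entries of column \<open>l\<close> down to
  the diagonal, weighted by \<open>u\<close>, add up to \<open>D\<^sub>l b\<^bsub>n-l\<^esub>\<close>, and the subdiagonal entry of that
  column, weighted by \<open>u\<^bsub>l+1\<^esub>\<close>, contributes the negative of this.  So \<open>u M\<close> vanishes outside its
  last entry, which is \<open>D\<^sub>i b\<^bsub>n-i\<^esub>\<close> because the subdiagonal of the last column lies outside \<open>M\<close>.
  Such a left vector evaluates a Hessenberg determinant (\<open>det_hessenberg_left_vector\<close>):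
  \<open>u\<^sub>1 det M = (-1)^(i - 1) D\<^sub>i b\<^bsub>n-i\<^esub> (\<Prod>c=1..i-1. - D\<^sub>c / (n - c))\<close>.  As \<open>P\<^sub>n\<close> is monic, \<open>u\<^sub>1 = n\<close>;
  as the eigenvalues are distinct, every \<open>D\<^sub>l\<close> is nonzero, and solving for \<open>b\<^bsub>n-i\<^esub>\<close> gives the
  formula.
\<close>

section \<open>A left vector that evaluates a Hessenberg determinant\<close>

text \<open>
  If all entries of \<open>u M\<close> but the last one vanish, then replacing the first row of \<open>M\<close> by \<open>u M\<close>
  multiplies the determinant by \<open>u 0\<close>.  The new first row is zero outside the last column, and
  deleting its row and column leaves an upper triangular matrix whose diagonal is the
  subdiagonal of \<open>M\<close>.
\<close>

lemma det_hessenberg_left_vector: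
  fixes H :: "nat \<Rightarrow> nat \<Rightarrow> 'a :: comm_ring_1" and u :: "nat \<Rightarrow> 'a"
  assumes hess: "\<And>r c. c + 1 < r \<Longrightarrow> r \<le> k \<Longrightarrow> H r c = 0"
    and orth: "\<And>c. c < k \<Longrightarrow> (\<Sum>r\<le>c. u r * H r c) + u (c + 1) * H (c + 1) c = 0"
  shows "u 0 * det (mat (Suc k) (Suc k) (\<lambda>(r, c). H r c)) =
    (-1) ^ k * (\<Sum>r\<le>k. u r * H r k) * (\<Prod>c<k. H (c + 1) c)"
proof -
  define M where "M = mat (Suc k) (Suc k) (\<lambda>(r, c). H r c)"
  \<comment> \<open>Multiplying by \<open>U\<close> from the left is the row replacement.\<close>
  define U where "U = mat (Suc k) (Suc k) (\<lambda>(r, c). if r = 0 then u c else if r = c then 1 else 0)"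
  define w where "w = (\<Sum>r\<le>k. u r * H r k)"
  define B where "B = mat (Suc k) (Suc k)
    (\<lambda>(r, c). if r = 0 then (if c = k then w else 0) else H r c)"
  have UM: "U * M = B"
  proof (rule eq_matI)
    fix r c assume "r < dim_row B" "c < dim_col B"
    then have rc: "r < Suc k" "c < Suc k" by (auto simp: B_def)
    have entry: "(U * M) $$ (r, c) =
        (\<Sum>s<Suc k. (if r = 0 then u s else if r = s then 1 else 0) * H s c)"
      using rc by (simp add: U_def M_def scalar_prod_def atLeast0LessThan)
    show "(U * M) $$ (r, c) = B $$ (r, c)"
    proof (cases "r = 0")
      case False
      have "(\<Sum>s<Suc k. (if r = s then 1 else 0) * H s c) = (\<Sum>s<Suc k. if r = s then H s c else 0)"
        by (intro sum.cong) auto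
      also have "\<dots> = H r c" using rc by (subst sum.delta') auto
      finally show ?thesis using entry False rc by (simp add: B_def)
    next
      case True
      show ?thesis
      proof (cases "c = k")
        case True
        then show ?thesis using entry rc \<open>r = 0\<close> by (simp add: B_def w_def lessThan_Suc_atMost)
      next
        case False
        then have ck: "c < k" using rc by simp
        have "(\<Sum>s<Suc k. u s * H s c) = (\<Sum>s\<le>c + 1. u s * H s c)"
          by (rule sum.mono_neutral_right) (use ck hess in auto)
        also have "\<dots> = 0" using orth[OF ck] by simp
        finally show ?thesis using entry rc \<open>r = 0\<close> False by (simp add: B_def)
      qed
    qed
  qed (auto simp: U_def M_def B_def)
  have "det U = prod_list (diag_mat U)"
    by (rule det_upper_triangular[of _ "Suc k"]) (auto simp: U_def upper_triangular_def)
  also have "\<dots> = u 0"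
    by (simp add: prod_list_diag_prod U_def atLeast0LessThan prod.lessThan_Suc_shift
        del: prod.lessThan_Suc)
  finally have detU: "det U = u 0" .
  have delete: "mat_delete B 0 k = mat k k (\<lambda>(r, c). H (r + 1) c)"
    by (rule eq_matI) (auto simp: mat_delete_def B_def)
  have "det (mat_delete B 0 k) = prod_list (diag_mat (mat_delete B 0 k))"
    unfolding delete
    by (rule det_upper_triangular[of _ k]) (use hess in \<open>auto simp: upper_triangular_def\<close>)
  also have "\<dots> = (\<Prod>c<k. H (c + 1) c)"
    unfolding delete by (simp add: prod_list_diag_prod atLeast0LessThan)
  finally have detdel: "det (mat_delete B 0 k) = (\<Prod>c<k. H (c + 1) c)" .
  have "det B = (\<Sum>c<Suc k. B $$ (0, c) * cofactor B 0 c)"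
    by (rule laplace_expansion_row) (auto simp: B_def)
  also have "\<dots> = w * cofactor B 0 k"
    by (simp add: B_def)
  also have "\<dots> = (-1) ^ k * w * (\<Prod>c<k. H (c + 1) c)"
    by (simp add: cofactor_def detdel)
  finally have "det B = (-1) ^ k * w * (\<Prod>c<k. H (c + 1) c)" .
  moreover have "det B = u 0 * det M"
    unfolding UM[symmetric] detU[symmetric]
    by (rule det_mult[of _ "Suc k"]) (auto simp: U_def M_def)
  ultimately show ?thesis by (simp add: M_def w_def)
qed

section \<open>Lagrange interpolation at \<open>0, \<dots>, N\<close>\<close>

text \<open>
  The Lagrange denominator at the node \<open>s\<close>.  Up to its sign it is \<open>fact N\<close> divided by
  \<open>N choose s\<close>, which is why signed binomial coefficients serve as interpolation weights below.
\<close>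

lemma prod_differences_other_nodes:
  assumes "s \<le> N"
  shows "(\<Prod>j\<in>{0..N} - {s}. of_nat s - of_nat j :: 'a :: {comm_ring_1, semiring_char_0}) =
    (-1) ^ (N - s) * fact s * fact (N - s)"
proof -
  have split: "{0..N} - {s} = {..<s} \<union> {s<..N}" using assms by auto
  have "(\<Prod>j\<in>{0..N} - {s}. of_nat s - of_nat j :: 'a) =
      (\<Prod>j<s. of_nat s - of_nat j) * (\<Prod>j\<in>{s<..N}. of_nat s - of_nat j)"
    unfolding split by (rule prod.union_disjoint) auto
  also have "(\<Prod>j<s. of_nat s - of_nat j :: 'a) = (\<Prod>j\<in>{1..s}. of_nat j)"
    by (rule prod.reindex_bij_witness[of _ "\<lambda>j. s - j" "\<lambda>j. s - j"]) (auto simp: of_nat_diff)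
  also have "\<dots> = fact s" by (simp add: fact_prod)
  also have "(\<Prod>j\<in>{s<..N}. of_nat s - of_nat j :: 'a) = (\<Prod>j\<in>{1..N - s}. (-1) * of_nat j)"
    by (rule prod.reindex_bij_witness[of _ "\<lambda>j. s + j" "\<lambda>j. j - s"])
      (use assms in \<open>auto simp: of_nat_diff\<close>)
  also have "\<dots> = (-1) ^ (N - s) * (\<Prod>j\<in>{1..N - s}. of_nat j)"
    by (simp only: prod.distrib) simp
  also have "(\<Prod>j\<in>{1..N - s}. of_nat j :: 'a) = fact (N - s)"
    by (simp add: fact_prod)
  finally show ?thesis by (simp add: ac_simps)
qed

text \<open>
  Both sides are polynomials in \<open>x\<close> of degree at most \<open>N\<close>, and at a node \<open>s\<close> only the summand
  \<open>r = s\<close> survives, so they agree at \<open>N + 1\<close> points.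
\<close>

lemma lagrange_interpolation_initial_nodes:
  fixes p :: "'a :: field_char_0 poly"
  assumes deg: "degree p \<le> N"
  shows "fact N * poly p x =
    (\<Sum>r=0..N. (-1) ^ (N - r) * of_nat (N choose r) * (\<Prod>j\<in>{0..N} - {r}. x - of_nat j) *
       poly p (of_nat r))"
proof -
  define q where "q = (\<Sum>r=0..N. smult ((-1) ^ (N - r) * of_nat (N choose r) * poly p (of_nat r))
    (\<Prod>j\<in>{0..N} - {r}. [:- of_nat j, 1:]))"
  have poly_q: "poly q y = (\<Sum>r=0..N. (-1) ^ (N - r) * of_nat (N choose r) *
      (\<Prod>j\<in>{0..N} - {r}. y - of_nat j) * poly p (of_nat r))" for y
    by (simp add: q_def poly_sum poly_prod algebra_simps)
  have "smult (fact N) p = q"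
  proof (rule poly_eqI_degree[of "of_nat ` {0..N}"])
    fix y :: 'a assume "y \<in> of_nat ` {0..N}"
    then obtain s where s: "s \<le> N" "y = of_nat s" by auto
    have "poly q y = (\<Sum>r=0..N. if r = s then (-1) ^ (N - r) * of_nat (N choose r) *
        (\<Prod>j\<in>{0..N} - {r}. y - of_nat j) * poly p (of_nat r) else 0)"
      unfolding poly_q by (intro sum.cong) (use s in auto)
    also have "\<dots> = (-1) ^ (N - s) * of_nat (N choose s) *
        (\<Prod>j\<in>{0..N} - {s}. of_nat s - of_nat j) * poly p (of_nat s)"
      using s by simp
    also have "\<dots> = ((-1) ^ (N - s) * (-1) ^ (N - s)) *
        of_nat (fact s * fact (N - s) * (N choose s)) * poly p (of_nat s)"
      unfolding prod_differences_other_nodes[OF s(1)] by (simp add: ac_simps)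
    also have "\<dots> = poly (smult (fact N) p) y"
      unfolding binomial_fact_lemma[OF s(1)] power_mult_distrib[symmetric] using s by simp
    finally show "poly (smult (fact N) p) y = poly q y" ..
  next
    have card: "card (of_nat ` {0..N} :: 'a set) = Suc N"
      by (subst card_image) (auto simp: inj_on_def)
    show "card (of_nat ` {0..N} :: 'a set) > degree (smult (fact N) p)"
      unfolding card using deg by simp
    have "degree q \<le> N"
      unfolding q_def
    proof (rule degree_sum_le)
      fix r assume r: "r \<in> {0..N}"
      have "degree (\<Prod>j\<in>{0..N} - {r}. [:- of_nat j, 1:] :: 'a poly) =
          (\<Sum>j\<in>{0..N} - {r}. degree [:- of_nat j, 1 :: 'a:])"
        by (rule degree_prod_eq_sum_degree) simp
      also have "\<dots> = N" using r by simp
      finally show "degree (smult ((-1) ^ (N - r) * of_nat (N choose r) * poly p (of_nat r))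
          (\<Prod>j\<in>{0..N} - {r}. [:- of_nat j, 1:])) \<le> N"
        using degree_smult_le by metis
    qed simp
    then show "card (of_nat ` {0..N} :: 'a set) > degree q" unfolding card by simp
  qed
  then have "poly (smult (fact N) p) x = poly q x" by simp
  then show ?thesis unfolding poly_q by simp
qed

section \<open>The operator on monomials\<close>

text \<open>
  The polynomial in \<open>m\<close> that extends \<open>m \<mapsto> assoc_seq a k m\<close>: the factor
  \<open>(m choose i) * fact i\<close> is the falling factorial \<open>m (m - 1) \<cdots> (m - i + 1)\<close>.
\<close>

definition assoc_poly :: "nat \<Rightarrow> (nat \<Rightarrow> complex poly) \<Rightarrow> nat \<Rightarrow> complex poly" where
  "assoc_poly N a k =
    (\<Sum>i=k..N. smult (coeff (a i) (i - k)) (\<Prod>j<i. [:- of_nat j, 1:]))"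

lemma degree_assoc_poly: "degree (assoc_poly N a k) \<le> N"
  unfolding assoc_poly_def
proof (rule degree_sum_le)
  fix i assume i: "i \<in> {k..N}"
  have "degree (\<Prod>j<i. [:- of_nat j, 1:] :: complex poly) =
      (\<Sum>j<i. degree [:- of_nat j, 1 :: complex:])"
    by (rule degree_prod_eq_sum_degree) simp
  also have "\<dots> = i" by simp
  finally show "degree (smult (coeff (a i) (i - k)) (\<Prod>j<i. [:- of_nat j, 1:])) \<le> N"
    using degree_smult_le i by (metis atLeastAtMost_iff le_trans)
qed simp

lemma poly_assoc_poly_of_nat:
  "poly (assoc_poly N a k) (of_nat m) =
    (\<Sum>i=k..N. of_nat (m choose i) * fact i * coeff (a i) (i - k))"
proof -
  have "of_nat (m choose i) * fact i = (\<Prod>j<i. of_nat m - of_nat j :: complex)" for i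
    by (simp add: binomial_gbinomial gbinomial_prod_rev atLeast0LessThan)
  then show ?thesis
    by (simp add: assoc_poly_def poly_sum poly_prod mult.commute)
qed

text \<open>
  The summation ranges \<open>{k..N}\<close> and \<open>{k..m}\<close> may differ in either direction: beyond \<open>m\<close> the binomial
  coefficient vanishes, beyond \<open>N\<close> the coefficient \<open>a i\<close> does.  In particular the polynomial has the
  roots \<open>0, \<dots>, k - 1\<close>, in accordance with the convention for \<open>k > m\<close>.
\<close>

lemma assoc_poly_eq_assoc_seq:
  assumes "bochner_operator N a"
  shows "poly (assoc_poly N a k) (of_nat m) = assoc_seq a k m"
proof (cases "k \<le> m")
  case True
  have "(\<Sum>i=k..N. of_nat (m choose i) * fact i * coeff (a i) (i - k)) =
      (\<Sum>i=k..min N m. of_nat (m choose i) * fact i * coeff (a i) (i - k))"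
    by (rule sum.mono_neutral_right) auto
  also have "\<dots> = (\<Sum>i=k..m. of_nat (m choose i) * fact i * coeff (a i) (i - k))"
    by (rule sum.mono_neutral_left) (use assms in \<open>auto simp: bochner_operator_def\<close>)
  finally show ?thesis using True by (simp add: poly_assoc_poly_of_nat assoc_seq_def)
qed (auto simp: poly_assoc_poly_of_nat assoc_seq_def intro!: sum.neutral)

lemma pochhammer_of_nat_Suc:
  "pochhammer (of_nat (Suc s)) i = (of_nat ((s + i) choose i) * fact i :: 'a :: field_char_0)"
proof -
  have "of_nat ((s + i) choose i) = (of_nat (s + i) gchoose i :: 'a)"
    by (rule binomial_gbinomial)
  also have "\<dots> = pochhammer (of_nat (Suc s)) i / fact i"
    by (subst gbinomial_pochhammer') (simp add: add.commute)
  finally show ?thesis by simp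
qed

text \<open>
  A term \<open>c x^(i - k)\<close> of \<open>a i\<close> times \<open>\<partial>^i\<close> lowers exponents by \<open>k\<close>.  Grouping the terms of \<open>L\<close>
  by this drop \<open>k\<close> rather than by the order \<open>i\<close> of the derivative shows that the monomial \<open>x^m\<close>
  contributes with the weight \<open>assoc_poly\<close> at \<open>m\<close> to the coefficient at \<open>x^(m - k)\<close>.  The bound
  \<open>degree (a i) \<le> i\<close> ensures \<open>k \<ge> 0\<close>.
\<close>

lemma coeff_apply_operator:
  assumes L: "bochner_operator N a"
  shows "coeff (apply_operator N a p) s =
    (\<Sum>k=0..N. poly (assoc_poly N a k) (of_nat (s + k)) * coeff p (s + k))"
proof -
  define F where "F i k = of_nat ((s + k) choose i) * fact i * coeff (a i) (i - k) * coeff p (s + k)"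
    for i k
  have summand: "coeff (a i * (pderiv ^^ i) p) s = (\<Sum>k=0..i. F i k)" if i: "i \<le> N" for i
  proof -
    have "coeff (a i * (pderiv ^^ i) p) s =
        (\<Sum>t\<le>s. coeff (a i) t * (pochhammer (of_nat (Suc (s - t))) i * coeff p (s - t + i)))"
      by (simp add: coeff_mult coeff_higher_pderiv)
    also have "\<dots> = (\<Sum>t\<in>{0..min s i}.
        coeff (a i) t * (pochhammer (of_nat (Suc (s - t))) i * coeff p (s - t + i)))"
    proof (rule sum.mono_neutral_right)
      have "coeff (a i) t = 0" if "t > i" for t
        using L i that by (intro coeff_eq_0) (auto simp: bochner_operator_def intro: le_less_trans)
      then show "\<forall>t\<in>{..s} - {0..min s i}. coeff (a i) t *
          (pochhammer (of_nat (Suc (s - t))) i * coeff p (s - t + i)) = 0"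
        by auto
    qed auto
    \<comment> \<open>Pass from the exponent \<open>t\<close> in \<open>a i\<close> to the drop \<open>k = i - t\<close>; the values \<open>k < i - s\<close> may be
        added afterwards because then \<open>s + k < i\<close> and the \<open>i\<close>-th derivative kills \<open>x^(s + k)\<close>.\<close>
    also have "\<dots> = (\<Sum>k\<in>{i - min s i..i}. F i k)"
      by (rule sum.reindex_bij_witness[of _ "\<lambda>k. i - k" "\<lambda>t. i - t"])
        (auto simp: F_def pochhammer_of_nat_Suc mult_ac simp del: of_nat_Suc)
    also have "\<dots> = (\<Sum>k=0..i. F i k)"
      by (rule sum.mono_neutral_left) (auto simp: F_def)
    finally show ?thesis .
  qed
  have "coeff (apply_operator N a p) s = (\<Sum>i=0..N. \<Sum>k=0..i. F i k)"
    unfolding apply_operator_def coeff_sum by (intro sum.cong summand) auto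
  also have "\<dots> = (\<Sum>k=0..N. \<Sum>i=k..N. F i k)"
    by (simp add: sum.Sigma)
      (rule sum.reindex_bij_witness[of _ prod.swap prod.swap]; auto)
  also have "\<dots> = (\<Sum>k=0..N. poly (assoc_poly N a k) (of_nat (s + k)) * coeff p (s + k))"
    by (simp only: poly_assoc_poly_of_nat F_def sum_distrib_right)
  finally show ?thesis .
qed

section \<open>Eigenpolynomials\<close>

lemma eigenvalue_eq_assoc_poly:
  assumes L: "bochner_operator N a" and "degree p = m" and "lead_coeff p = 1"
    and "apply_operator N a p = smult c p"
  shows "c = poly (assoc_poly N a 0) (of_nat m)"
proof -
  have "c = coeff (apply_operator N a p) m" using assms by simp
  also have "\<dots> = (\<Sum>k=0..N. if k = 0 then poly (assoc_poly N a 0) (of_nat m) else 0)"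
    unfolding coeff_apply_operator[OF L]
    by (intro sum.cong) (use assms in \<open>auto simp: coeff_eq_0\<close>)
  finally show ?thesis by simp
qed

lemma eigenpolynomial_recurrence:
  assumes L: "bochner_operator N a" and "apply_operator N a p = smult c p"
  shows "(c - poly (assoc_poly N a 0) (of_nat s)) * coeff p s =
    (\<Sum>k=1..N. poly (assoc_poly N a k) (of_nat (s + k)) * coeff p (s + k))"
proof -
  have "c * coeff p s = coeff (apply_operator N a p) s" using assms by simp
  also have "\<dots> = poly (assoc_poly N a 0) (of_nat s) * coeff p s +
      (\<Sum>k=1..N. poly (assoc_poly N a k) (of_nat (s + k)) * coeff p (s + k))"
    unfolding coeff_apply_operator[OF L] by (simp add: sum.atLeast_Suc_atMost)
  finally show ?thesis by (simp add: algebra_simps)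
qed

section \<open>The entries of the matrix\<close>

text \<open>
  Lagrange's formula at the point \<open>n + 1 - l\<close>.  Only nodes \<open>r \<ge> k \<ge> 1\<close> can carry a nonzero value, so
  the product over \<open>{0..N} - {r}\<close> always contains the factor for the node \<open>0\<close>, which is
  \<open>n + 1 - l\<close> itself; the matrix entries have this factor divided out.
\<close>

lemma super_entry_eq_assoc_poly:
  assumes L: "bochner_operator N a" and "1 \<le> k" "l \<le> n + 1"
  shows "of_nat (n + 1 - l) * super_entry N a n k l =
    fact N * poly (assoc_poly N a k) (of_nat (n + 1 - l))"
proof -
  let ?x = "of_nat n - of_nat l + 1 :: complex"
  let ?t = "\<lambda>A r. (-1) ^ (N - r) * of_nat (N choose r) * (\<Prod>j\<in>A - {r}. ?x - of_nat j) *
      assoc_seq a k r"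
  have x: "of_nat (n + 1 - l) = ?x" using assms by (simp add: of_nat_diff)
  have "fact N * poly (assoc_poly N a k) ?x = (\<Sum>r=0..N. ?t {0..N} r)"
    unfolding lagrange_interpolation_initial_nodes[OF degree_assoc_poly]
      assoc_poly_eq_assoc_seq[OF L] ..
  also have "\<dots> = (\<Sum>r=k..N. ?t {0..N} r)"
    by (rule sum.mono_neutral_right) (auto simp: assoc_seq_def)
  also have "\<dots> = (\<Sum>r=k..N. ?x * ?t {1..N} r)"
  proof (rule sum.cong)
    fix r assume "r \<in> {k..N}"
    then have "{0..N} - {r} = insert 0 ({1..N} - {r})" using assms(2) by auto
    then show "?t {0..N} r = ?x * ?t {1..N} r" by simp
  qed simp
  also have "\<dots> = ?x * super_entry N a n k l"
    unfolding super_entry_def by (simp only: sum_distrib_left)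
  finally show ?thesis unfolding x ..
qed

lemma hessenberg_entry_eq_super_entry:
  assumes "N \<ge> 1" "r \<le> c"
  shows "hessenberg_entry N a lam n r c =
    (if c - r + 1 \<le> N then super_entry N a n (c - r + 1) r else 0)"
proof -
  consider "r = c" | "r < c" "c - r + 1 \<le> N - 1" | "r < c" "c - r + 1 = N" | "r < c" "c - r + 1 > N"
    using assms by linarith
  then show ?thesis
  proof cases
    case 3
    then show ?thesis
      unfolding hessenberg_entry_def Let_def
      by (simp only: super_entry_eq_last_super_entry[OF assms(1)]) simp
  qed (use assms in \<open>simp_all add: hessenberg_entry_def\<close>)
qed

text \<open>
  The part of a matrix column on and above the diagonal, weighted by \<open>(n - r) * coeff p (n - r)\<close>, is
  \<open>N!\<close> times the right-hand side of the recurrence for \<open>coeff p (n - (l + 1))\<close>: the weight \<open>n - r\<close> restores the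
  factor divided out of the entry, and row \<open>r\<close> corresponds to the drop \<open>k = l - r + 1\<close>.  Rows and
  columns are counted from \<open>0\<close> here, hence the shifts by one.
\<close>

lemma hessenberg_column_sum:
  assumes "N \<ge> 1" and L: "bochner_operator N a" and "degree p = n"
    and eigen: "apply_operator N a p = smult mu p" and "l < n"
  shows "(\<Sum>r\<le>l. of_nat (n - r) * coeff p (n - r) * hessenberg_entry N a lam n (r + 1) (l + 1)) =
    fact N * (mu - poly (assoc_poly N a 0) (of_nat (n - (l + 1)))) * coeff p (n - (l + 1))"
proof -
  let ?s = "n - (l + 1)"
  let ?T = "\<lambda>k. poly (assoc_poly N a k) (of_nat (?s + k)) * coeff p (?s + k)"
  have "(\<Sum>r\<le>l. of_nat (n - r) * coeff p (n - r) * hessenberg_entry N a lam n (r + 1) (l + 1)) =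
      (\<Sum>r\<le>l. if l - r + 1 \<le> N then fact N * ?T (l - r + 1) else 0)"
  proof (rule sum.cong)
    fix r assume r: "r \<in> {..l}"
    have "of_nat (n - r) * super_entry N a n (l - r + 1) (r + 1) =
        fact N * poly (assoc_poly N a (l - r + 1)) (of_nat (n - r))"
      using super_entry_eq_assoc_poly[OF L, of "l - r + 1" "r + 1" n] r \<open>l < n\<close> by simp
    moreover have "?s + (l - r + 1) = n - r" using r \<open>l < n\<close> by auto
    ultimately show "of_nat (n - r) * coeff p (n - r) *
        hessenberg_entry N a lam n (r + 1) (l + 1) =
        (if l - r + 1 \<le> N then fact N * ?T (l - r + 1) else 0)"
      using r hessenberg_entry_eq_super_entry[OF \<open>N \<ge> 1\<close>, of "r + 1" "l + 1" a lam n]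
      by (simp only:) (simp add: mult_ac)
  qed simp
  also have "\<dots> = (\<Sum>k\<in>{1..l + 1}. if k \<le> N then fact N * ?T k else 0)"
    by (rule sum.reindex_bij_witness[of _ "\<lambda>k. l + 1 - k" "\<lambda>r. l - r + 1"]) auto
  also have "\<dots> = (\<Sum>k\<in>{1..min (l + 1) N}. fact N * ?T k)"
    by (rule sum.mono_neutral_cong_right) auto
  \<comment> \<open>For \<open>k > l + 1\<close> the index \<open>?s + k\<close> exceeds the degree \<open>n\<close>.\<close>
  also have "\<dots> = (\<Sum>k\<in>{1..N}. fact N * ?T k)"
  proof (rule sum.mono_neutral_left)
    show "\<forall>k\<in>{1..N} - {1..min (l + 1) N}. fact N * ?T k = 0"
      using \<open>degree p = n\<close> \<open>l < n\<close> by (auto intro!: coeff_eq_0)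
  qed auto
  also have "\<dots> = fact N * (\<Sum>k=1..N. ?T k)" by (simp only: sum_distrib_left)
  also have "(\<Sum>k=1..N. ?T k) = (mu - poly (assoc_poly N a 0) (of_nat ?s)) * coeff p ?s"
    using eigenpolynomial_recurrence[OF L eigen] by simp
  finally show ?thesis by (simp add: mult.assoc)
qed

theorem corollary1:
  fixes N n i :: nat
    and a :: "nat \<Rightarrow> complex poly"
    and P :: "nat \<Rightarrow> complex poly"
    and lam :: "nat \<Rightarrow> complex"
  assumes "N \<ge> 1"
    and "bochner_operator N a"
    and "a 0 = 0"
    and "\<And>m. degree (P m) = m"
    and "\<And>m. lead_coeff (P m) = 1"
    and "\<And>m. apply_operator N a (P m) = smult (lam m) (P m)"
    and "lam 0 = 0"
    and "\<And>m. m \<ge> 1 \<Longrightarrow> lam m \<noteq> 0"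
    and "inj lam"
    and "1 \<le> i" and "i \<le> n" and "n - i \<ge> N"
  shows "coeff (P n) (n - i) =
    (\<Prod>j<i. of_nat n - of_nat j) /
    (\<Prod>l=1..i. \<Sum>m=1..N. (-1) ^ (N - m) * of_nat (N choose m) *
        ((\<Prod>j\<in>{0..N} - {m}. of_nat n - of_nat j) -
         (\<Prod>j\<in>{0..N} - {m}. of_nat n - of_nat l - of_nat j)) * lam m)
    * det (hessenberg_mat N a lam n i)"
proof -
  note L = assms(2)
  define D where "D l = fact N * (lam n - lam (n - l))" for l
  define b where "b = coeff (P n)"
  \<comment> \<open>The left vector, and the matrix, with indices counted from \<open>0\<close>.\<close>
  define u where "u r = of_nat (n - r) * b (n - r)" for r
  define H where "H r c = hessenberg_entry N a lam n (r + 1) (c + 1)" for r c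
  have lam: "lam m = poly (assoc_poly N a 0) (of_nat m)" for m
    by (rule eigenvalue_eq_assoc_poly[OF L]) (use assms in auto)
  have interp: "fact N * lam m = (\<Sum>r=1..N. (-1) ^ (N - r) * of_nat (N choose r) *
      (\<Prod>j\<in>{0..N} - {r}. of_nat m - of_nat j) * lam r)" for m
    unfolding lam lagrange_interpolation_initial_nodes[OF degree_assoc_poly]
    by (rule sum.mono_neutral_right) (use assms(7) in \<open>auto simp: lam not_less_eq_eq\<close>)
  have denom: "(\<Sum>m=1..N. (-1) ^ (N - m) * of_nat (N choose m) *
        ((\<Prod>j\<in>{0..N} - {m}. of_nat n - of_nat j) -
         (\<Prod>j\<in>{0..N} - {m}. of_nat n - of_nat l - of_nat j)) * lam m) = D l"
    if "l \<le> n" for l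
  proof -
    have "D l = fact N * lam n - fact N * lam (n - l)" by (simp add: D_def algebra_simps)
    also have "\<dots> = (\<Sum>m=1..N. (-1) ^ (N - m) * of_nat (N choose m) *
        ((\<Prod>j\<in>{0..N} - {m}. of_nat n - of_nat j) -
         (\<Prod>j\<in>{0..N} - {m}. of_nat n - of_nat l - of_nat j)) * lam m)"
      unfolding interp of_nat_diff[OF that] by (simp add: algebra_simps sum_subtractf)
    finally show ?thesis ..
  qed
  have sub: "sub_entry N lam n l = - D l / of_nat (n - l)" if "l \<le> n" for l
  proof -
    have "sub_entry N lam n l = 1 / (of_nat n - of_nat l) * - (\<Sum>m=1..N. (-1) ^ (N - m) *
        of_nat (N choose m) * ((\<Prod>j\<in>{0..N} - {m}. of_nat n - of_nat j) -
         (\<Prod>j\<in>{0..N} - {m}. of_nat n - of_nat l - of_nat j)) * lam m)"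
      unfolding sub_entry_def sum_negf[symmetric]
      by (intro arg_cong[where f = "\<lambda>x. _ * x"] sum.cong) (auto simp: algebra_simps)
    then show ?thesis using that by (simp only: denom) (simp add: of_nat_diff)
  qed
  have subdiag: "H (c + 1) c = - D (c + 1) / of_nat (n - (c + 1))" if "c < n" for c
    using that sub[of "c + 1"] by (simp add: H_def hessenberg_entry_def)
  \<comment> \<open>For \<open>c + 1 < n\<close> the subdiagonal entry of this column, weighted by \<open>u (c + 1)\<close>, is the negative
      of this sum.\<close>
  have column: "(\<Sum>r\<le>c. u r * H r c) = D (c + 1) * b (n - (c + 1))" if "c < n" for c
    using hessenberg_column_sum[OF assms(1) L assms(4) assms(6) that, of lam]
    by (simp add: u_def H_def D_def b_def lam)
  obtain k where k: "i = Suc k" using \<open>1 \<le> i\<close> by (cases i) auto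
  have "u 0 * det (mat (Suc k) (Suc k) (\<lambda>(r, c). H r c)) =
      (-1) ^ k * (\<Sum>r\<le>k. u r * H r k) * (\<Prod>c<k. H (c + 1) c)"
  proof (rule det_hessenberg_left_vector)
    fix c assume "c < k"
    then have "c < n" "n - (c + 1) > 0" using \<open>i \<le> n\<close> k by auto
    then obtain d where d: "n - (c + 1) = Suc d" using gr0_implies_Suc by blast
    show "(\<Sum>r\<le>c. u r * H r c) + u (c + 1) * H (c + 1) c = 0"
      unfolding column[OF \<open>c < n\<close>] subdiag[OF \<open>c < n\<close>] u_def[of "c + 1"] d by (simp del: of_nat_Suc)
  qed (simp add: H_def hessenberg_entry_def)
  moreover have "mat (Suc k) (Suc k) (\<lambda>(r, c). H r c) = hessenberg_mat N a lam n i"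
    by (simp add: hessenberg_mat_def H_def k)
  moreover have "u 0 = of_nat n"
    using assms(4)[of n] assms(5)[of n] by (simp add: u_def b_def)
  moreover have "(\<Prod>c<k. H (c + 1) c) =
      (-1) ^ k * (\<Prod>c<k. D (c + 1)) / (\<Prod>c<k. of_nat (n - (c + 1)))"
  proof -
    have "(\<Prod>c<k. H (c + 1) c) = (\<Prod>c<k. (-1) * D (c + 1) / of_nat (n - (c + 1)))"
      using \<open>i \<le> n\<close> k by (intro prod.cong) (auto simp: subdiag[simplified])
    then show ?thesis by (simp only: prod_dividef prod.distrib) simp
  qed
  moreover have "(\<Sum>r\<le>k. u r * H r k) = D i * b (n - i)"
    using column[of k] \<open>i \<le> n\<close> k by simp
  ultimately have det: "of_nat n * det (hessenberg_mat N a lam n i) =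
      ((-1) ^ k * (-1) ^ k) * (D i * (\<Prod>c<k. D (c + 1))) * b (n - i) /
      (\<Prod>c<k. of_nat (n - (c + 1)))"
    by (simp add: mult_ac)
  have "(\<Prod>c<k. of_nat (n - (c + 1)) :: complex) \<noteq> 0"
    using \<open>i \<le> n\<close> k by (simp only: prod_zero_iff finite_lessThan of_nat_eq_0_iff) auto
  moreover have "(-1) ^ k * (-1) ^ k = (1 :: complex)"
    by (simp flip: power_mult_distrib)
  ultimately have "of_nat n * (\<Prod>c<k. of_nat (n - (c + 1))) * det (hessenberg_mat N a lam n i) =
      (D i * (\<Prod>c<k. D (c + 1))) * b (n - i)"
    using det by (simp add: field_simps)
  moreover have "of_nat n * (\<Prod>c<k. of_nat (n - (c + 1))) = (\<Prod>j<i. of_nat n - of_nat j :: complex)"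
    unfolding k prod.lessThan_Suc_shift using \<open>i \<le> n\<close> k
    by (auto intro!: prod.cong simp: of_nat_diff)
  moreover have "D i * (\<Prod>c<k. D (c + 1)) = (\<Prod>l=1..i. D l)"
    by (simp add: k prod.atLeast1_atMost_eq mult.commute)
  ultimately have main: "(\<Prod>j<i. of_nat n - of_nat j) * det (hessenberg_mat N a lam n i) =
      (\<Prod>l=1..i. D l) * b (n - i)"
    by simp
  have "D l \<noteq> 0" if "l \<in> {1..i}" for l
    using that \<open>i \<le> n\<close> injD[OF \<open>inj lam\<close>, of n "n - l"] by (auto simp: D_def)
  then have "(\<Prod>l=1..i. D l) \<noteq> 0" by simp
  moreover have "(\<Prod>l=1..i. \<Sum>m=1..N. (-1) ^ (N - m) * of_nat (N choose m) *
        ((\<Prod>j\<in>{0..N} - {m}. of_nat n - of_nat j) -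
         (\<Prod>j\<in>{0..N} - {m}. of_nat n - of_nat l - of_nat j)) * lam m) = (\<Prod>l=1..i. D l)"
    using \<open>i \<le> n\<close> by (intro prod.cong denom) auto
  ultimately show ?thesis using main by (simp add: b_def field_simps)
qed

end
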